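(* There is no conjugation $C$ on $H^2$ such that $C(M)=M^\perp$ for all $M\in\mathcal{M}(S)$.
   Context: $H^2$ is the Hardy–Hilbert space of the unit disk, with shift $S:H^2\to H^2$, $(Sf)(z)=zf(z)$. A conjugation on a complex Hilbert space $\mathcal{H}$ is an antilinear map $C:\mathcal{H}\to\mathcal{H}$ such that $\langle Cf, Cg\rangle = \langle g,f\rangle$ and $C^2h=h$ for all $f,g,h\in\mathcal{H}$. $\mathcal{M}(S)$ is the collection of all closed $S$-invariant subspaces $M$ of $H^2$ with $\dim M=\infty=\dim M^\perp$; equivalently, $\mathcal{M}(S)=\{\theta H^2:\theta \text{ is an inner function that is not a finite Blaschke product}\}$ (unimodular constants being counted as finite Blaschke products). $M^\perp$ is the orthogonal complement of $M$ in $H^2$. *)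

theory Defs
  imports "HOL-Complex_Analysis.Complex_Analysis"
begin

section \<open>The Hardy--Hilbert space of the unit disk\<close>

definition taylor_coeff :: "(complex \<Rightarrow> complex) \<Rightarrow> nat \<Rightarrow> complex" where
  "taylor_coeff f n = (deriv ^^ n) f 0 / fact n"

text \<open>
  Elements of the Hardy space are functions on the open unit disk.  Functions in HOL are total, so
  they are normalised to be zero off the disk; equality in the type is then equality on the disk.
\<close>
definition hardy_set :: "(complex \<Rightarrow> complex) set" where
  "hardy_set = {f. f holomorphic_on ball 0 1 \<and> (\<forall>z. z \<notin> ball 0 1 \<longrightarrow> f z = 0) \<and>
                   summable (\<lambda>n. (cmod (taylor_coeff f n))\<^sup>2)}"

lemma taylor_coeff_zero [simp]: "taylor_coeff (\<lambda>z. 0) n = 0"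
  by (simp add: taylor_coeff_def)

lemma taylor_coeff_add:
  "f holomorphic_on ball 0 1 \<Longrightarrow> g holomorphic_on ball 0 1 \<Longrightarrow>
     taylor_coeff (\<lambda>z. f z + g z) n = taylor_coeff f n + taylor_coeff g n"
  unfolding taylor_coeff_def
  by (subst higher_deriv_add[where S = "ball 0 1"]) (auto simp: add_divide_distrib)

lemma taylor_coeff_cmult:
  "f holomorphic_on ball 0 1 \<Longrightarrow> taylor_coeff (\<lambda>z. c * f z) n = c * taylor_coeff f n"
  unfolding taylor_coeff_def
  by (subst higher_deriv_cmult[where A = "ball 0 1"]) auto

lemma taylor_coeff_shift:
  assumes "f holomorphic_on ball 0 1"
  shows "taylor_coeff (\<lambda>z. z * f z) n = (case n of 0 \<Rightarrow> 0 | Suc m \<Rightarrow> taylor_coeff f m)"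
proof -
  have "f has_fps_expansion fps_expansion f 0"
    using assms by (intro has_fps_expansion_fps_expansion[of "ball 0 1"]) auto
  hence "(\<lambda>z. z * f z) has_fps_expansion fps_X * fps_expansion f 0"
    by (intro fps_expansion_intros)
  from fps_nth_fps_expansion[OF this, of n] show ?thesis
    by (cases n) (auto simp: taylor_coeff_def fps_expansion_def)
qed

lemma summable_square_cmod_add:
  fixes a b :: "nat \<Rightarrow> complex"
  assumes "summable (\<lambda>n. (cmod (a n))\<^sup>2)" "summable (\<lambda>n. (cmod (b n))\<^sup>2)"
  shows "summable (\<lambda>n. (cmod (a n + b n))\<^sup>2)"
proof (rule summable_comparison_test')
  show "summable (\<lambda>n. 2 * (cmod (a n))\<^sup>2 + 2 * (cmod (b n))\<^sup>2)"
    using assms by (intro summable_add summable_mult)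
  show "norm ((cmod (a n + b n))\<^sup>2) \<le> 2 * (cmod (a n))\<^sup>2 + 2 * (cmod (b n))\<^sup>2" if "n \<ge> 0" for n
  proof -
    have "(cmod (a n + b n))\<^sup>2 \<le> (cmod (a n) + cmod (b n))\<^sup>2"
      by (intro power_mono norm_triangle_ineq) auto
    also have "\<dots> \<le> 2 * (cmod (a n))\<^sup>2 + 2 * (cmod (b n))\<^sup>2"
      using zero_le_power2[of "cmod (a n) - cmod (b n)"] by (simp add: power2_eq_square algebra_simps)
    finally show ?thesis by simp
  qed
qed

lemma summable_mult_cnj:
  fixes a b :: "nat \<Rightarrow> complex"
  assumes "summable (\<lambda>n. (cmod (a n))\<^sup>2)" "summable (\<lambda>n. (cmod (b n))\<^sup>2)"
  shows "summable (\<lambda>n. a n * cnj (b n))"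
proof (rule summable_comparison_test')
  show "summable (\<lambda>n. (cmod (a n))\<^sup>2 + (cmod (b n))\<^sup>2)"
    using assms by (rule summable_add)
  show "norm (a n * cnj (b n)) \<le> (cmod (a n))\<^sup>2 + (cmod (b n))\<^sup>2" if "n \<ge> 0" for n
  proof -
    have "2 * (cmod (a n) * cmod (b n)) \<le> (cmod (a n))\<^sup>2 + (cmod (b n))\<^sup>2"
      using zero_le_power2[of "cmod (a n) - cmod (b n)"] by (simp add: power2_eq_square algebra_simps)
    moreover have "cmod (a n) * cmod (b n) \<ge> 0" by simp
    ultimately have "cmod (a n) * cmod (b n) \<le> (cmod (a n))\<^sup>2 + (cmod (b n))\<^sup>2" by linarith
    thus ?thesis by (simp add: norm_mult)
  qed
qed

lemma hardy_set_zero: "(\<lambda>z. 0) \<in> hardy_set"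
  by (auto simp: hardy_set_def)

lemma hardy_set_add: "f \<in> hardy_set \<Longrightarrow> g \<in> hardy_set \<Longrightarrow> (\<lambda>z. f z + g z) \<in> hardy_set"
  by (auto simp: hardy_set_def taylor_coeff_add summable_square_cmod_add intro!: holomorphic_intros)

lemma hardy_set_cmult: "f \<in> hardy_set \<Longrightarrow> (\<lambda>z. c * f z) \<in> hardy_set"
  by (auto simp: hardy_set_def taylor_coeff_cmult norm_mult power_mult_distrib
           intro!: holomorphic_intros summable_mult)

lemma hardy_set_shift: "f \<in> hardy_set \<Longrightarrow> (\<lambda>z. z * f z) \<in> hardy_set"
  by (auto simp: hardy_set_def taylor_coeff_shift intro!: holomorphic_intros
           intro: summable_Suc_iff[THEN iffD1])

typedef hardy = hardy_set morphisms hardy_fun Abs_hardy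
  using hardy_set_zero by blast

setup_lifting type_definition_hardy

definition hcoeff :: "hardy \<Rightarrow> nat \<Rightarrow> complex" where
  "hcoeff f = taylor_coeff (hardy_fun f)"

lemma hardy_fun_holomorphic: "hardy_fun f holomorphic_on ball 0 1"
  using hardy_fun[of f] by (simp add: hardy_set_def)

lemma hardy_fun_outside: "z \<notin> ball 0 1 \<Longrightarrow> hardy_fun f z = 0"
  using hardy_fun[of f] by (auto simp: hardy_set_def)

lemma summable_hcoeff: "summable (\<lambda>n. (cmod (hcoeff f n))\<^sup>2)"
  using hardy_fun[of f] by (simp add: hardy_set_def hcoeff_def)

lift_definition hscale :: "complex \<Rightarrow> hardy \<Rightarrow> hardy" (infixr \<open>*\<^sub>H\<close> 75)
  is "\<lambda>c f z. c * f z"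
  by (rule hardy_set_cmult)

lift_definition shift :: "hardy \<Rightarrow> hardy"
  is "\<lambda>f z. z * f z"
  by (rule hardy_set_shift)

definition hinner :: "hardy \<Rightarrow> hardy \<Rightarrow> complex" where
  "hinner f g = (\<Sum>n. hcoeff f n * cnj (hcoeff g n))"

lemma summable_hinner: "summable (\<lambda>n. hcoeff f n * cnj (hcoeff g n))"
  by (intro summable_mult_cnj summable_hcoeff)

text \<open>
  The topology, metric and norm of the type are those induced by \<^const>\<open>hinner\<close>; the real inner product
  of the type class \<open>real_inner\<close> is its real part.
\<close>
instantiation hardy :: real_inner
begin

lift_definition zero_hardy :: hardy is "\<lambda>z. 0"
  by (rule hardy_set_zero)

lift_definition plus_hardy :: "hardy \<Rightarrow> hardy \<Rightarrow> hardy" is "\<lambda>f g z. f z + g z"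
  by (rule hardy_set_add)

definition uminus_hardy :: "hardy \<Rightarrow> hardy" where
  "- f = (-1) *\<^sub>H f"

definition minus_hardy :: "hardy \<Rightarrow> hardy \<Rightarrow> hardy" where
  "f - g = f + - (g :: hardy)"

definition scaleR_hardy :: "real \<Rightarrow> hardy \<Rightarrow> hardy" where
  "scaleR r f = complex_of_real r *\<^sub>H f"

definition inner_hardy :: "hardy \<Rightarrow> hardy \<Rightarrow> real" where
  "inner f g = Re (hinner f g)"

definition norm_hardy :: "hardy \<Rightarrow> real" where
  "norm (f :: hardy) = sqrt (inner f f)"

definition sgn_hardy :: "hardy \<Rightarrow> hardy" where
  "sgn (f :: hardy) = inverse (norm f) *\<^sub>R f"

definition dist_hardy :: "hardy \<Rightarrow> hardy \<Rightarrow> real" where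
  "dist (f :: hardy) g = norm (f - g)"

definition uniformity_hardy :: "(hardy \<times> hardy) filter" where
  "uniformity_hardy = (INF e\<in>{0<..}. principal {(f, g). dist f g < e})"

definition open_hardy :: "hardy set \<Rightarrow> bool" where
  "open_hardy U = (\<forall>f\<in>U. eventually (\<lambda>(f', g). f' = f \<longrightarrow> g \<in> U) uniformity)"

lemma hcoeff_add: "hcoeff (f + g) n = hcoeff f n + hcoeff g n"
  unfolding hcoeff_def by transfer (auto simp: hardy_set_def taylor_coeff_add)

lemma hcoeff_hscale: "hcoeff (c *\<^sub>H f) n = c * hcoeff f n"
  unfolding hcoeff_def by transfer (auto simp: hardy_set_def taylor_coeff_cmult)

lemma hcoeff_zero: "hcoeff 0 n = 0"
  unfolding hcoeff_def by transfer simp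

lemma hcoeff_eqI:
  assumes "\<And>n. hcoeff f n = hcoeff g n"
  shows "f = g"
proof -
  have "hardy_fun f z = hardy_fun g z" for z
  proof (cases "z \<in> ball 0 1")
    case True
    show ?thesis
      using assms
      by (intro holomorphic_fun_eq_on_ball[OF hardy_fun_holomorphic hardy_fun_holomorphic True])
         (auto simp: hcoeff_def taylor_coeff_def)
  qed (simp add: hardy_fun_outside)
  thus ?thesis by (metis hardy_fun_inject ext)
qed

lemma hinner_commute: "hinner g f = cnj (hinner f g)"
  unfolding hinner_def
  by (subst bounded_linear.suminf[OF bounded_linear_cnj]) (auto simp: summable_hinner mult.commute)

lemma hinner_add_left: "hinner (f + g) h = hinner f h + hinner g h"
  unfolding hinner_def by (subst suminf_add) (auto simp: summable_hinner hcoeff_add ring_distribs)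

lemma hinner_hscale_left: "hinner (c *\<^sub>H f) g = c * hinner f g"
  unfolding hinner_def
  by (subst suminf_mult[symmetric]) (auto simp: summable_hinner hcoeff_hscale mult.assoc)

lemma hinner_self: "hinner f f = of_real (\<Sum>n. (cmod (hcoeff f n))\<^sup>2)"
  unfolding hinner_def
  by (subst suminf_of_real) (auto simp: summable_hcoeff complex_norm_square simp del: of_real_power)

instance
proof
  fix f g h :: hardy and r s :: real and U :: "hardy set"
  show "f + g + h = f + (g + h)" "f + g = g + f" "0 + f = f"
    by (transfer; simp add: add_ac)+
  show "- f + f = 0" unfolding uminus_hardy_def by transfer simp
  show "f - g = f + - g" by (rule minus_hardy_def)
  show "r *\<^sub>R (f + g) = r *\<^sub>R f + r *\<^sub>R g"
       "(r + s) *\<^sub>R f = r *\<^sub>R f + s *\<^sub>R f"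
       "r *\<^sub>R s *\<^sub>R f = (r * s) *\<^sub>R f" "1 *\<^sub>R f = f"
    unfolding scaleR_hardy_def by (transfer; simp add: algebra_simps)+
  show "sgn f = inverse (norm f) *\<^sub>R f" by (rule sgn_hardy_def)
  show "dist f g = norm (f - g)" by (rule dist_hardy_def)
  show "uniformity = (INF e\<in>{0<..}. principal {(f :: hardy, g). dist f g < e})"
    by (rule uniformity_hardy_def)
  show "open U \<longleftrightarrow> (\<forall>f\<in>U. \<forall>\<^sub>F (f', g) in uniformity. f' = f \<longrightarrow> g \<in> U)"
    by (rule open_hardy_def)
  show "inner f g = inner g f"
    by (simp add: inner_hardy_def hinner_commute[of g f])
  show "inner (f + g) h = inner f h + inner g h"
    by (simp add: inner_hardy_def hinner_add_left)
  show "inner (r *\<^sub>R f) g = r * inner f g"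
    by (simp add: inner_hardy_def scaleR_hardy_def hinner_hscale_left)
  show "inner f f \<ge> 0"
    by (simp add: inner_hardy_def hinner_self suminf_nonneg summable_hcoeff)
  show "inner f f = 0 \<longleftrightarrow> f = 0"
  proof
    assume "inner f f = 0"
    hence "(\<Sum>n. (cmod (hcoeff f n))\<^sup>2) = 0"
      by (simp add: inner_hardy_def hinner_self)
    hence "hcoeff f n = 0" for n
      by (subst (asm) suminf_eq_zero_iff) (auto simp: summable_hcoeff)
    thus "f = 0" by (intro hcoeff_eqI) (simp add: hcoeff_zero)
  next
    assume "f = 0"
    thus "inner f f = 0" by (simp add: inner_hardy_def hinner_self hcoeff_zero)
  qed
  show "norm f = sqrt (inner f f)" by (rule norm_hardy_def)
qed

end

text \<open>\<open>hardy.subspace\<close> and \<open>hardy.span\<close> are the notions of linear algebra over the complex field.\<close>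

global_interpretation hardy: vector_space hscale
  by unfold_locales (transfer; simp add: algebra_simps)+

section \<open>Conjugations and the lattice of shift-invariant subspaces\<close>

definition conjugation :: "(hardy \<Rightarrow> hardy) \<Rightarrow> bool" where
  "conjugation C \<longleftrightarrow>
     (\<forall>f g. C (f + g) = C f + C g) \<and>
     (\<forall>c f. C (c *\<^sub>H f) = cnj c *\<^sub>H C f) \<and>
     (\<forall>f g. hinner (C f) (C g) = hinner g f) \<and>
     (\<forall>h. C (C h) = h)"

definition orth_complement :: "hardy set \<Rightarrow> hardy set" where
  "orth_complement M = {f. \<forall>g\<in>M. hinner f g = 0}"

definition infinite_dimensional :: "hardy set \<Rightarrow> bool" where
  "infinite_dimensional M \<longleftrightarrow> \<not> (\<exists>B. finite B \<and> M \<subseteq> hardy.span B)"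

text \<open>Only the invariant subspaces of infinite dimension and infinite codimension are collected.\<close>
definition shift_invariant_subspaces :: "hardy set set" where
  "shift_invariant_subspaces =
     {M. hardy.subspace M \<and> closed M \<and> shift ` M \<subseteq> M \<and>
         infinite_dimensional M \<and> infinite_dimensional (orth_complement M)}"

end

theory Submission
  imports Defs
begin

text \<open>
  A conjugation maps a larger set to a larger set, whereas orthogonal complements reverse
  inclusions. So as soon as \<open>M \<subseteq> N\<close> are two members of the lattice, the hypothesis on \<open>C\<close> gives
  \<open>M\<^sup>\<bottom> = C M \<subseteq> C N = N\<^sup>\<bottom>\<close>, and it suffices to exhibit such a pair with a vector that is
  orthogonal to \<open>M\<close> but not to \<open>N\<close>.

  For an infinite set \<open>Z\<close> of points of the disk, let \<open>N\<close> consist of the functions that vanish on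
  \<open>Z\<close> and let \<open>M\<close> consist of those that vanish at \<open>0\<close> as well. The constant function \<open>1\<close> is the
  reproducing kernel at \<open>0\<close>: it is orthogonal to \<open>M\<close>, and it is orthogonal to \<open>N\<close> only if every
  function in \<open>N\<close> vanishes at \<open>0\<close>. Hence everything rests on one function \<open>f\<close> in the Hardy space
  with \<open>f 0 \<noteq> 0\<close> and infinitely many zeros (\<open>exists_hardy_infinite_zeros\<close>), whose zero set serves
  as \<open>Z\<close>.

  That the spaces belong to the lattice
  (\<open>vanishing_on_in_shift_invariant_subspaces\<close>) also comes from kernels and from \<open>f\<close>.
  A space of functions with prescribed zeros is the orthogonal complement of a set of kernels,
  hence closed. It is infinite-dimensional because it contains all the shifts of one nonzero
  function, and its complement is infinite-dimensional because it contains the kernels at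
  infinitely many points, which polynomials separate.

  A Blaschke product would be a possible \<open>f\<close>, but a closed formula avoids infinite products. The
  singular inner function \<open>exp ((z + 1) / (z - 1))\<close> takes the value \<open>exp (-2)\<close> infinitely often
  and is bounded; multiplying the difference by \<open>(1 - z)\<^sup>2\<close> makes its derivative
  bounded too, and then Cauchy's estimates for the derivative show that the Taylor coefficients
  are square-summable.
\<close>

section \<open>Constructing elements of the Hardy space\<close>

lemma hardy_element_exists:
  assumes hol: "F holomorphic_on ball 0 1"
    and sq: "summable (\<lambda>n. (cmod (taylor_coeff F n))\<^sup>2)"
  shows "\<exists>h. (\<forall>z\<in>ball 0 1. hardy_fun h z = F z) \<and> (\<forall>n. hcoeff h n = taylor_coeff F n)"
proof -
  define G where "G = (\<lambda>z. if z \<in> ball 0 1 then F z else 0)"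
  have "eventually (\<lambda>z. G z = F z) (nhds 0)"
    by (rule eventually_mono[OF eventually_nhds_in_open[of "ball 0 1"]]) (auto simp: G_def)
  then have tc: "taylor_coeff G n = taylor_coeff F n" for n
    unfolding taylor_coeff_def by (simp add: higher_deriv_cong_ev)
  have "G holomorphic_on ball 0 1"
    by (rule holomorphic_transform[OF hol]) (simp add: G_def)
  with sq have "G \<in> hardy_set"
    unfolding hardy_set_def by (auto simp: tc) (simp add: G_def)
  then have "hardy_fun (Abs_hardy G) = G"
    by (rule Abs_hardy_inverse)
  then show ?thesis
    by (intro exI[of _ "Abs_hardy G"]) (simp add: hcoeff_def tc, simp add: G_def)
qed

text \<open>Cauchy's estimates for the derivative give coefficients of order \<open>1 / n\<close>.\<close>
lemma summable_taylor_coeff_if_bounded_deriv: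
  assumes hol: "F holomorphic_on ball 0 1"
    and bound: "\<And>z. z \<in> ball 0 1 \<Longrightarrow> cmod (deriv F z) \<le> B"
  shows "summable (\<lambda>n. (cmod (taylor_coeff F n))\<^sup>2)"
proof -
  have hol': "deriv F holomorphic_on ball 0 1"
    by (intro holomorphic_deriv hol) simp
  have coeff_le: "cmod ((deriv ^^ n) (deriv F) 0) / fact n \<le> B" for n
  proof -
    have le: "cmod ((deriv ^^ n) (deriv F) 0) / fact n * r ^ n \<le> B" if r: "0 < r" "r < 1" for r
    proof -
      have "cmod ((deriv ^^ n) (deriv F) 0) \<le> fact n * B / r ^ n"
      proof (rule Cauchy_inequality)
        show "deriv F holomorphic_on ball 0 r"
          using r by (intro holomorphic_on_subset[OF hol']) auto
        show "continuous_on (cball 0 r) (deriv F)"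
          using r by (intro holomorphic_on_imp_continuous_on holomorphic_on_subset[OF hol']) auto
      qed (use r bound in auto)
      then show ?thesis
        using r by (simp add: field_simps)
    qed
    have "((\<lambda>r. cmod ((deriv ^^ n) (deriv F) 0) / fact n * r ^ n) \<longlongrightarrow>
             cmod ((deriv ^^ n) (deriv F) 0) / fact n * 1 ^ n) (at_left (1::real))"
      by (intro tendsto_intros)
    moreover have "eventually (\<lambda>r. cmod ((deriv ^^ n) (deriv F) 0) / fact n * r ^ n \<le> B)
                     (at_left (1::real))"
      using eventually_at_left_real[of 0 1] by (rule eventually_mono) (use le in auto)
    ultimately show ?thesis
      using tendsto_upperbound[of _ _ "at_left (1::real)"] by fastforce
  qed
  have "summable (\<lambda>n. (cmod (taylor_coeff F (Suc n)))\<^sup>2)"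
  proof (rule summable_comparison_test')
    have "summable (\<lambda>n. inverse ((real (Suc n))\<^sup>2))"
      using inverse_power_summable[of 2, where ?'a = real] by (subst summable_Suc_iff) simp
    then show "summable (\<lambda>n. B\<^sup>2 * inverse ((real (Suc n))\<^sup>2))"
      by (rule summable_mult)
    fix n :: nat
    have "cmod (taylor_coeff F (Suc n)) = cmod ((deriv ^^ n) (deriv F) 0) / fact n / real (Suc n)"
      unfolding taylor_coeff_def funpow_Suc_right o_def
      by (simp add: norm_divide norm_mult del: of_nat_Suc)
    also have "\<dots> \<le> B / real (Suc n)"
      using coeff_le[of n] by (intro divide_right_mono) auto
    finally have "(cmod (taylor_coeff F (Suc n)))\<^sup>2 \<le> (B / real (Suc n))\<^sup>2"
      by (intro power_mono) auto
    then show "norm ((cmod (taylor_coeff F (Suc n)))\<^sup>2) \<le> B\<^sup>2 * inverse ((real (Suc n))\<^sup>2)"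
      by (simp add: divide_inverse power_mult_distrib power_inverse del: of_nat_Suc)
  qed
  then show ?thesis
    by (subst (asm) summable_Suc_iff)
qed

section \<open>Reproducing kernels\<close>

text \<open>
  For \<open>a\<close> in the open unit disk this is the function \<open>\<lambda>w. 1 / (1 - cnj a * w)\<close>; for other \<open>a\<close> the
  coefficients are not square-summable and the value is arbitrary.
\<close>
definition szego_kernel :: "complex \<Rightarrow> hardy" where
  "szego_kernel a = (SOME h. \<forall>n. hcoeff h n = cnj a ^ n)"

lemma hcoeff_kernel:
  assumes "a \<in> ball 0 1"
  shows "hcoeff (szego_kernel a) n = cnj a ^ n"
proof -
  let ?F = "\<lambda>w. inverse (1 - cnj a * w)"
  have nz: "1 - cnj a * w \<noteq> 0" if "w \<in> ball 0 1" for w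
  proof
    assume "1 - cnj a * w = 0"
    then have "cmod (cnj a * w) = 1" by simp
    moreover have "cmod a * cmod w < 1 * 1"
      using assms that by (intro mult_strict_mono) auto
    ultimately show False by (simp add: norm_mult)
  qed
  have "?F has_fps_expansion inverse (1 - fps_const (cnj a) * fps_X)"
    by (intro fps_expansion_intros) auto
  also have "inverse (1 - fps_const (cnj a) * fps_X) = Abs_fps (\<lambda>n. cnj a ^ n)"
  proof (rule fps_inverse_unique)
    have "((1 - fps_const (cnj a) * fps_X) * Abs_fps (\<lambda>n. cnj a ^ n)) $ n = fps_nth 1 n" for n
      by (cases n) (simp_all add: left_diff_distrib mult.assoc)
    then show "(1 - fps_const (cnj a) * fps_X) * Abs_fps (\<lambda>n. cnj a ^ n) = 1"
      by (simp add: fps_eq_iff)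
  qed
  finally have "?F has_fps_expansion Abs_fps (\<lambda>n. cnj a ^ n)" .
  from fps_nth_fps_expansion[OF this] have tc: "taylor_coeff ?F n = cnj a ^ n" for n
    by (simp add: taylor_coeff_def)
  have "summable (\<lambda>n. ((cmod a)\<^sup>2) ^ n)"
    using assms by (intro summable_geometric) (auto simp: abs_square_less_1)
  then have "summable (\<lambda>n. (cmod (taylor_coeff ?F n))\<^sup>2)"
    unfolding tc by (simp add: norm_power power_mult[symmetric] mult.commute)
  moreover have "?F holomorphic_on ball 0 1"
    using nz by (intro holomorphic_intros) auto
  ultimately have "\<exists>h. \<forall>n. hcoeff h n = cnj a ^ n"
    using hardy_element_exists[of ?F] tc by auto
  from someI_ex[OF this] show ?thesis
    by (simp add: szego_kernel_def)
qed

lemma hinner_kernel: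
  assumes "a \<in> ball 0 1"
  shows "hinner f (szego_kernel a) = hardy_fun f a"
proof -
  have "(\<lambda>n. (deriv ^^ n) (hardy_fun f) 0 / fact n * (a - 0) ^ n) sums hardy_fun f a"
    by (rule holomorphic_power_series[OF hardy_fun_holomorphic assms])
  then have "(\<lambda>n. hcoeff f n * cnj (hcoeff (szego_kernel a) n)) sums hardy_fun f a"
    unfolding hcoeff_kernel[OF assms] by (simp add: hcoeff_def taylor_coeff_def)
  then show ?thesis
    by (simp add: hinner_def sums_iff)
qed

lemma hinner_kernel_left:
  assumes "a \<in> ball 0 1"
  shows "hinner (szego_kernel a) f = cnj (hardy_fun f a)"
  using hinner_commute[of "szego_kernel a" f] hinner_kernel[OF assms] by simp

section \<open>Infinite-dimensional subspaces\<close>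

text \<open>
  The hypothesis is a triangularity condition. No \<open>y n\<close> is in the span of finitely many of its
  successors, so adding indices in decreasing order shows that every finite subfamily is linearly
  independent. The separating subspace may depend on the bound \<open>N\<close>, which is what allows kernels
  to be separated by polynomials: these have only finitely many zeros.
\<close>
lemma infinite_dimensionalI:
  fixes y :: "nat \<Rightarrow> hardy"
  assumes mem: "\<And>n. y n \<in> M"
    and sep: "\<And>n N. \<exists>W. hardy.subspace W \<and> y n \<notin> W \<and> (\<forall>m. n < m \<and> m < N \<longrightarrow> y m \<in> W)"
  shows "infinite_dimensional M"
  unfolding infinite_dimensional_def
proof (rule notI, elim exE conjE)
  fix B assume B: "finite B" "M \<subseteq> hardy.span B"
  have notin_span: "y n \<notin> hardy.span (y ` A)" if "finite A" "\<forall>m\<in>A. n < m" for n A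
  proof -
    obtain W where W: "hardy.subspace W" "y n \<notin> W" "\<forall>m. n < m \<and> m < Suc (Max A) \<longrightarrow> y m \<in> W"
      using sep by blast
    have "y ` A \<subseteq> W"
      using that W(3) by (auto simp: less_Suc_eq_le)
    with W(1,2) show ?thesis
      using hardy.span_minimal by blast
  qed
  have "hardy.independent (y ` A) \<and> inj_on y A" if "finite A" for A
    using that
  proof (induction rule: finite_linorder_min_induct)
    case (insert n A)
    have "y n \<notin> hardy.span (y ` A)"
      using insert notin_span by blast
    moreover from this have "y n \<notin> y ` A"
      using hardy.span_superset by blast
    ultimately show ?case
      using insert by (auto simp: hardy.independent_insert)
  qed (simp add: hardy.independent_empty)
  then have "hardy.independent (y ` {..card B})" "card (y ` {..card B}) = Suc (card B)"
    by (auto simp: card_image)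
  moreover have "y ` {..card B} \<subseteq> hardy.span B"
    using mem B(2) by blast
  ultimately show False
    using hardy.independent_span_bound[OF B(1)] by fastforce
qed

section \<open>Orthogonal complements\<close>

lemma hinner_zero_left [simp]: "hinner 0 g = 0"
  by (simp add: hinner_def hcoeff_zero)

lemma subspace_orth_complement: "hardy.subspace (orth_complement M)"
  by (auto simp: hardy.subspace_def orth_complement_def hinner_add_left hinner_hscale_left)

text \<open>
  Both the real and the imaginary part of the Hermitian product are given by the real inner
  product, so \<^const>\<open>hinner\<close> inherits its continuity.
\<close>
lemma hinner_eq_inner: "hinner f g = Complex (inner f g) (inner f (\<i> *\<^sub>H g))"
proof -
  have "hinner f (\<i> *\<^sub>H g) = - \<i> * hinner f g"
    using hinner_commute[of f "\<i> *\<^sub>H g"] hinner_commute[of f g] by (simp add: hinner_hscale_left)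
  then show ?thesis
    by (simp add: complex_eq_iff inner_hardy_def)
qed

lemma closed_orth_complement: "closed (orth_complement M)"
proof -
  have "orth_complement M = (\<Inter>g\<in>M. {f. inner f g = 0 \<and> inner f (\<i> *\<^sub>H g) = 0})"
    by (auto simp: orth_complement_def hinner_eq_inner complex_eq_iff)
  also have "closed \<dots>"
    by (intro closed_INT ballI closed_Collect_conj closed_Collect_eq continuous_intros)
  finally show ?thesis .
qed

section \<open>Subspaces of functions with prescribed zeros\<close>

definition vanishing_on :: "complex set \<Rightarrow> hardy set" where
  "vanishing_on Z = {f. \<forall>z\<in>Z. hardy_fun f z = 0}"

lemma vanishing_on_eq_orth_complement:
  "Z \<subseteq> ball 0 1 \<Longrightarrow> vanishing_on Z = orth_complement (szego_kernel ` Z)"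
  by (auto simp: vanishing_on_def orth_complement_def hinner_kernel subset_iff)

lemma kernel_in_orth_complement:
  "Z \<subseteq> ball 0 1 \<Longrightarrow> z \<in> Z \<Longrightarrow> szego_kernel z \<in> orth_complement (vanishing_on Z)"
  by (auto simp: vanishing_on_def orth_complement_def hinner_kernel_left subset_iff)

lemma shift_vanishing_on: "f \<in> vanishing_on Z \<Longrightarrow> shift f \<in> vanishing_on Z"
  by (simp add: vanishing_on_def shift.rep_eq)

lemma hcoeff_shift: "hcoeff (shift f) n = (case n of 0 \<Rightarrow> 0 | Suc m \<Rightarrow> hcoeff f m)"
  unfolding hcoeff_def shift.rep_eq by (rule taylor_coeff_shift[OF hardy_fun_holomorphic])

lemma hcoeff_funpow_shift:
  "hcoeff ((shift ^^ n) f) j = (if j < n then 0 else hcoeff f (j - n))"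
  by (induction n arbitrary: j) (auto simp: hcoeff_shift split: nat.split)

text \<open>
  The shifts of \<open>f\<close> have strictly increasing orders of vanishing at the origin.
\<close>
lemma infinite_dimensional_vanishing_on:
  assumes f: "f \<in> vanishing_on Z" "f \<noteq> 0"
  shows "infinite_dimensional (vanishing_on Z)"
proof -
  define k where "k = (LEAST k. hcoeff f k \<noteq> 0)"
  have "\<exists>k. hcoeff f k \<noteq> 0"
    using f(2) hcoeff_eqI[of f 0] by (auto simp: hcoeff_zero)
  then have k: "hcoeff f k \<noteq> 0" "\<And>j. j < k \<Longrightarrow> hcoeff f j = 0"
    unfolding k_def by (metis (mono_tags, lifting) LeastI_ex, metis (mono_tags, lifting) not_less_Least)
  show ?thesis
  proof (rule infinite_dimensionalI)
    show "(shift ^^ n) f \<in> vanishing_on Z" for n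
      by (induction n) (auto simp: f shift_vanishing_on)
    fix n N
    \<comment> \<open>The order of vanishing of \<open>(shift ^^ n) f\<close> at the origin is \<open>k + n\<close>.\<close>
    let ?W = "{g. hcoeff g (k + n) = 0}"
    have "hardy.subspace ?W"
      by (auto simp: hardy.subspace_def hcoeff_zero hcoeff_add hcoeff_hscale)
    moreover have "(shift ^^ n) f \<notin> ?W" "\<forall>m. n < m \<and> m < N \<longrightarrow> (shift ^^ m) f \<in> ?W"
      using k by (auto simp: hcoeff_funpow_shift)
    ultimately show "\<exists>W. hardy.subspace W \<and> (shift ^^ n) f \<notin> W \<and>
        (\<forall>m. n < m \<and> m < N \<longrightarrow> (shift ^^ m) f \<in> W)"
      by blast
  qed
qed

text \<open>The witness is the polynomial with simple zeros at the points of \<open>T\<close>.\<close>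
lemma hardy_separates_points:
  assumes "finite T" "a \<notin> T" "a \<in> ball 0 1"
  shows "\<exists>p. p \<in> vanishing_on T \<and> hardy_fun p a \<noteq> 0"
  using assms
proof (induction rule: finite_induct)
  case empty
  have "hardy_fun (szego_kernel 0) a = cnj (hardy_fun (szego_kernel a) 0)"
    using empty hinner_kernel[of a "szego_kernel 0"] hinner_kernel_left[of 0 "szego_kernel a"] by simp
  moreover have "hardy_fun (szego_kernel a) 0 = 1"
    using hcoeff_kernel[of a 0] empty by (simp add: hcoeff_def taylor_coeff_def)
  ultimately show ?case
    by (intro exI[of _ "szego_kernel 0"]) (simp add: vanishing_on_def)
next
  case (insert t T)
  then obtain p where "p \<in> vanishing_on T" "hardy_fun p a \<noteq> 0"
    by auto
  moreover have "hardy_fun (shift p + (- t) *\<^sub>H p) z = (z - t) * hardy_fun p z" for z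
    unfolding plus_hardy.rep_eq shift.rep_eq hscale.rep_eq by (simp add: algebra_simps)
  ultimately have "shift p + (- t) *\<^sub>H p \<in> vanishing_on (insert t T)"
            "hardy_fun (shift p + (- t) *\<^sub>H p) a \<noteq> 0"
    using insert.prems
    by (auto simp: vanishing_on_def simp del: hardy.scale_minus_left)
  then show ?case by blast
qed

lemma infinite_dimensional_orth_vanishing_on:
  assumes Z: "Z \<subseteq> ball 0 1" "infinite Z"
  shows "infinite_dimensional (orth_complement (vanishing_on Z))"
proof -
  obtain z :: "nat \<Rightarrow> complex" where z: "inj z" "range z \<subseteq> Z"
    using infinite_countable_subset[OF Z(2)] by auto
  show ?thesis
  proof (rule infinite_dimensionalI)
    show "szego_kernel (z n) \<in> orth_complement (vanishing_on Z)" for n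
      using z Z by (intro kernel_in_orth_complement) auto
    fix n N
    have ball: "z m \<in> ball 0 1" for m
      using z(2) Z(1) by blast
    obtain p where p: "p \<in> vanishing_on (z ` {n<..<N})" "hardy_fun p (z n) \<noteq> 0"
      using hardy_separates_points[of "z ` {n<..<N}" "z n"] ball[of n] z(1)
      by (auto simp: inj_eq image_iff)
    have "hardy.subspace (orth_complement {p})"
      by (rule subspace_orth_complement)
    moreover have "szego_kernel (z n) \<notin> orth_complement {p}"
                  "\<forall>m. n < m \<and> m < N \<longrightarrow> szego_kernel (z m) \<in> orth_complement {p}"
      using p ball by (auto simp: orth_complement_def hinner_kernel_left vanishing_on_def)
    ultimately show "\<exists>W. hardy.subspace W \<and> szego_kernel (z n) \<notin> W \<and>
        (\<forall>m. n < m \<and> m < N \<longrightarrow> szego_kernel (z m) \<in> W)"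
      by blast
  qed
qed

lemma vanishing_on_in_shift_invariant_subspaces:
  assumes Z: "Z \<subseteq> ball 0 1" "infinite Z" and f: "f \<in> vanishing_on Z" "f \<noteq> 0"
  shows "vanishing_on Z \<in> shift_invariant_subspaces"
proof -
  have "hardy.subspace (vanishing_on Z)" "closed (vanishing_on Z)"
    using Z(1)
    by (simp_all add: vanishing_on_eq_orth_complement subspace_orth_complement closed_orth_complement)
  then show ?thesis
    using infinite_dimensional_vanishing_on[OF f] infinite_dimensional_orth_vanishing_on[OF Z]
    by (auto simp: shift_invariant_subspaces_def shift_vanishing_on)
qed

section \<open>A function with infinitely many zeros\<close>

text \<open>
  On the disk, \<open>(z + 1) / (z - 1)\<close> has negative real part, so \<open>E\<close> below is bounded by \<open>1\<close>. The
  derivative of \<open>E\<close> is \<open>-2 * E z / (1 - z)\<^sup>2\<close>, and the factor \<open>(1 - z)\<^sup>2\<close> in \<open>F\<close> cancels its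
  singularity. The value \<open>c = exp (-2)\<close> is chosen different from \<open>E 0 = exp (-1)\<close> in order that
  \<open>F\<close> does not vanish at the origin.
\<close>
lemma exists_hardy_infinite_zeros:
  obtains f where "hardy_fun f 0 \<noteq> 0" "infinite {z \<in> ball 0 1. hardy_fun f z = 0}"
proof -
  define E where "E = (\<lambda>z::complex. exp ((z + 1) / (z - 1)))"
  define c :: complex where "c = exp (-2)"
  define F where "F = (\<lambda>z. (1 - z)\<^sup>2 * (E z - c))"
  have norm_E: "cmod (E z) \<le> 1" if "z \<in> ball 0 1" for z
  proof -
    have "(cmod z)\<^sup>2 < 1"
      using that by (simp add: abs_square_less_1)
    moreover have "Re ((z + 1) / (z - 1)) = ((cmod z)\<^sup>2 - 1) / (cmod (z - 1))\<^sup>2"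
      by (simp add: Re_divide cmod_power2) (simp add: power2_eq_square algebra_simps)
    ultimately have "Re ((z + 1) / (z - 1)) \<le> 0"
      by (simp add: divide_nonpos_nonneg)
    then show ?thesis
      by (simp add: E_def)
  qed
  have deriv_F: "(F has_field_derivative - 2 * (1 - z) * (E z - c) - 2 * E z) (at z)"
    if "z \<in> ball 0 1" for z
  proof -
    have nz: "z - 1 \<noteq> 0" "1 - z \<noteq> 0"
      using that by auto
    have "(E has_field_derivative E z * (- 2 / (1 - z)\<^sup>2)) (at z)"
      unfolding E_def using nz
      by (auto intro!: derivative_eq_intros simp: power2_eq_square divide_simps)
         (auto simp: algebra_simps)
    then have "(F has_field_derivative
        (1 - z)\<^sup>2 * (E z * (- 2 / (1 - z)\<^sup>2)) + (- 2 * (1 - z)) * (E z - c)) (at z)"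
      unfolding F_def by (auto intro!: derivative_eq_intros)
    then show ?thesis
      using nz by (simp add: algebra_simps)
  qed
  have hol: "F holomorphic_on ball 0 1"
    using deriv_F by (subst holomorphic_on_open) blast+
  have "cmod (deriv F z) \<le> 10" if z: "z \<in> ball 0 1" for z
  proof -
    have "cmod c \<le> 1" by (simp add: c_def)
    have "cmod (1 - z) \<le> 2"
      using norm_triangle_ineq4[of 1 z] z by simp
    moreover have "cmod (E z - c) \<le> 2"
      using norm_triangle_ineq4[of "E z" c] norm_E[OF z] \<open>cmod c \<le> 1\<close> by linarith
    ultimately have "cmod (1 - z) * cmod (E z - c) \<le> 2 * 2"
      by (intro mult_mono) auto
    moreover have "cmod (deriv F z) \<le> cmod (- 2 * (1 - z) * (E z - c)) + cmod (2 * E z)"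
      unfolding DERIV_imp_deriv[OF deriv_F[OF z]] by (rule norm_triangle_ineq4)
    moreover have "cmod (- 2 * (1 - z) * (E z - c)) = 2 * (cmod (1 - z) * cmod (E z - c))"
      unfolding norm_mult by simp
    moreover have "cmod (2 * E z) \<le> 2"
      using norm_E[OF z] by (simp add: norm_mult)
    ultimately show ?thesis
      by linarith
  qed
  then have "summable (\<lambda>n. (cmod (taylor_coeff F n))\<^sup>2)"
    by (rule summable_taylor_coeff_if_bounded_deriv[OF hol])
  from hardy_element_exists[OF hol this] obtain f where f: "\<And>z. z \<in> ball 0 1 \<Longrightarrow> hardy_fun f z = F z"
    by blast
  \<comment> \<open>The point \<open>\<zeta> k\<close> solves \<open>(1 + z) / (1 - z) = w k\<close>. It lies in the disk because
      \<open>Re (w k) > 0\<close>, and it is a zero of \<open>F\<close> because \<open>w k\<close> differs from \<open>2\<close> by a period of the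
      exponential function.\<close>
  define w where "w = (\<lambda>k::nat. 2 + of_real (2 * pi * real k) * \<i>)"
  define \<zeta> where "\<zeta> = (\<lambda>k. (w k - 1) / (w k + 1))"
  have w1: "w k + 1 \<noteq> 0" for k
    by (simp add: w_def complex_eq_iff)
  have ball: "\<zeta> k \<in> ball 0 1" for k
  proof -
    have "(cmod (w k - 1))\<^sup>2 < (cmod (w k + 1))\<^sup>2"
      by (simp add: w_def cmod_power2)
    then have "cmod (w k - 1) < cmod (w k + 1)"
      by (rule power2_less_imp_less) simp
    then show ?thesis
      using w1[of k] by (simp add: \<zeta>_def norm_divide)
  qed
  have E_\<zeta>: "E (\<zeta> k) = c" for k
  proof -
    have "(\<zeta> k + 1) / (\<zeta> k - 1) = - w k"
    proof -
      have "\<zeta> k + 1 = 2 * w k / (w k + 1)" "\<zeta> k - 1 = - 2 / (w k + 1)"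
        using w1[of k] by (auto simp: \<zeta>_def field_simps)
      then show ?thesis
        using w1[of k] by simp
    qed
    moreover have "exp (w k) = exp 2"
      unfolding w_def exp_eq by (rule exI[of _ "int k"]) (simp add: mult_ac)
    ultimately show ?thesis
      by (simp add: E_def c_def exp_minus)
  qed
  have "inj \<zeta>"
  proof (rule injI)
    fix j k assume "\<zeta> j = \<zeta> k"
    then have "w j = w k"
      using w1[of j] w1[of k] by (simp add: \<zeta>_def divide_simps) (simp add: algebra_simps)
    then show "j = k"
      by (simp add: w_def)
  qed
  then have "infinite (range \<zeta>)"
    by (simp add: finite_image_iff)
  moreover have "range \<zeta> \<subseteq> {z \<in> ball 0 1. hardy_fun f z = 0}"
    using ball E_\<zeta> f by (auto simp: F_def)
  ultimately have "infinite {z \<in> ball 0 1. hardy_fun f z = 0}"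
    using finite_subset by blast
  moreover have "hardy_fun f 0 \<noteq> 0"
  proof -
    have "Re (exp (- 1 :: complex)) \<noteq> Re (exp (- 2))"
      by (simp add: Re_exp)
    then show ?thesis
      using f[of 0] by (auto simp: F_def E_def c_def)
  qed
  ultimately show thesis
    by (rule that[rotated])
qed

section \<open>Nonexistence of the conjugation\<close>

theorem theorem3p1:
  shows "\<not> (\<exists>C. conjugation C \<and>
              (\<forall>M\<in>shift_invariant_subspaces. C ` M = orth_complement M))"
proof (rule notI, elim exE conjE)
  fix C assume C: "\<forall>M\<in>shift_invariant_subspaces. C ` M = orth_complement M"
  obtain f where f: "hardy_fun f 0 \<noteq> 0" and inf: "infinite {z \<in> ball 0 1. hardy_fun f z = 0}"
    by (rule exists_hardy_infinite_zeros)
  define Z where "Z = {z \<in> ball 0 1. hardy_fun f z = 0}"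
  let ?N = "vanishing_on Z" and ?M = "vanishing_on (insert 0 Z)"
  have Z: "insert 0 Z \<subseteq> ball 0 1" "infinite (insert 0 Z)" "Z \<subseteq> ball 0 1" "infinite Z"
    using inf by (auto simp: Z_def)
  have "f \<in> ?N" and "f \<noteq> 0"
    using f by (auto simp: vanishing_on_def Z_def zero_hardy.rep_eq)
  have "shift f \<in> ?M"
    using \<open>f \<in> ?N\<close> by (auto simp: vanishing_on_def shift.rep_eq)
  obtain k where "hcoeff f k \<noteq> 0"
    using \<open>f \<noteq> 0\<close> hcoeff_eqI[of f 0] by (auto simp: hcoeff_zero)
  then have "hcoeff (shift f) (Suc k) \<noteq> 0"
    by (simp add: hcoeff_shift)
  then have "shift f \<noteq> 0"
    by (auto simp: hcoeff_zero)
  have "szego_kernel 0 \<in> orth_complement ?M"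
    using Z by (intro kernel_in_orth_complement) auto
  also have "orth_complement ?M = C ` ?M"
    using C vanishing_on_in_shift_invariant_subspaces[OF Z(1,2) \<open>shift f \<in> ?M\<close> \<open>shift f \<noteq> 0\<close>] by simp
  also have "C ` ?M \<subseteq> C ` ?N"
    by (auto simp: vanishing_on_def)
  also have "C ` ?N = orth_complement ?N"
    using C vanishing_on_in_shift_invariant_subspaces[OF Z(3,4) \<open>f \<in> ?N\<close> \<open>f \<noteq> 0\<close>] by simp
  finally have "hinner (szego_kernel 0) f = 0"
    using \<open>f \<in> ?N\<close> by (simp add: orth_complement_def)
  with f show False
    by (simp add: hinner_kernel_left)
qed

end
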